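(* Let $\mathcal{G}$ be a simple, connected, undirected graph on $n$ vertices with graph Laplacian matrix $L\in\mathbb{R}^{n\times n}$, and let $\mathbf{r}\in\mathbb{R}^n$ satisfy $\mathbf{1}_n^{\top}\mathbf{r}=0$. Fix an index $i\in\{1,\dots,n\}$, let $\widehat{L}\in\mathbb{R}^{(n-1)\times(n-1)}$ be the matrix obtained from $L$ by deleting its $i$th row and $i$th column, and let $\widehat{\mathbf{r}}\in\mathbb{R}^{n-1}$ be the vector obtained from $\mathbf{r}$ by deleting its $i$th entry. If $\widehat{\mathbf{z}}^{\ast}\in\mathbb{R}^{n-1}$ is the solution of $\widehat{L}\widehat{\mathbf{z}}=\widehat{\mathbf{r}}$, then the $n$-vector $$\mathbf{z}^{\ast}:=\begin{bmatrix}\widehat{\mathbf{z}}^{\ast}(1{:}i-1)\\ 0\\ \widehat{\mathbf{z}}^{\ast}(i{:}n-1)\end{bmatrix}-\frac{\widehat{\mathbf{1}}_n^{\top}\widehat{\mathbf{z}}^{\ast}}{n}\,\mathbf{1}_n$$ is a solution of $L\mathbf{z}=\mathbf{r}$ that is orthogonal to $\mathbf{1}_n$, i.e. $L\mathbf{z}^{\ast}=\mathbf{r}$ and $\mathbf{1}_n^{\top}\mathbf{z}^{\ast}=0$.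
   Context: The graph Laplacian matrix of a simple undirected graph $\mathcal{G}=(\mathcal{V},\mathcal{E})$ with $n$ vertices is $L=D-A$, where $A$ is the adjacency matrix ($A_{jk}=1$ if $jk\in\mathcal{E}$ and $0$ otherwise) and $D$ is the diagonal matrix with $D_{jj}=\sum_{k}A_{jk}$; thus $L^{\top}=L$ and $L\mathbf{1}_n=\mathbf{0}$. $\mathbf{1}_n\in\mathbb{R}^n$ denotes the all-ones vector, and $\widehat{\mathbf{1}}_n:=\mathbf{1}_{n-1}\in\mathbb{R}^{n-1}$. For a vector $\mathbf{v}$, $\mathbf{v}(p{:}q)$ denotes the subvector consisting of its $p$th to $q$th entries (empty if $p>q$). By a known fact, $\widehat{L}$ is nonsingular (it is a nonsingular M-matrix). *)

theory Defs
  imports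
    "Graph_Theory.Pair_Digraph"
    "Graph_Theory.Digraph_Component"
    "Jordan_Normal_Form.Matrix"
    "Jordan_Normal_Form.Determinant"
begin

text \<open>
  A simple undirected graph on \<open>n\<close> vertices is a \<^locale>\<open>pair_graph\<close> with vertex set
  \<open>{0..<n}\<close>; an undirected edge \<open>jk\<close> is the pair of arcs \<open>(j, k)\<close> and \<open>(k, j)\<close>. Vertices,
  matrix rows and columns, and vector entries are all counted from 0.
\<close>

definition adjacency_mat :: "nat \<Rightarrow> nat pair_pre_digraph \<Rightarrow> real mat" where
  "adjacency_mat n G = mat n n (\<lambda>(j, k). if (j, k) \<in> parcs G then 1 else 0)"

definition degree_mat :: "nat \<Rightarrow> nat pair_pre_digraph \<Rightarrow> real mat" where
  "degree_mat n G =
     mat_diag n (\<lambda>j. \<Sum>k = 0..<n. adjacency_mat n G $$ (j, k))"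

definition laplacian_mat :: "nat \<Rightarrow> nat pair_pre_digraph \<Rightarrow> real mat" where
  "laplacian_mat n G = degree_mat n G - adjacency_mat n G"

definition ones_vec :: "nat \<Rightarrow> real vec" where
  "ones_vec n = vec n (\<lambda>_. 1)"

text \<open>The analogue of \<^const>\<open>mat_delete\<close> for vectors.\<close>

definition vec_delete :: "'a vec \<Rightarrow> nat \<Rightarrow> 'a vec" where
  "vec_delete v i = vec (dim_vec v - 1) (\<lambda>k. v $ (if k < i then k else Suc k))"

text \<open>
  The inverse operation: with \<open>i\<close> counted from 0, \<open>vec_first v i\<close> holds the entries before
  position \<open>i\<close> and \<open>vec_last v (dim_vec v - i)\<close> the entries from position \<open>i\<close> on.
\<close>

definition vec_insert_zero :: "'a :: zero vec \<Rightarrow> nat \<Rightarrow> 'a vec" where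
  "vec_insert_zero v i = vec_first v i @\<^sub>v 0\<^sub>v 1 @\<^sub>v vec_last v (dim_vec v - i)"

end

theory Submission
  imports Defs
begin

text \<open>
  Write \<open>y\<close> for \<open>z_hat\<close> with a zero put back in position \<open>i\<close>, so that \<open>z = y - c 1\<close>, where
  \<open>c\<close> is the mean of the entries of \<open>y\<close>. Subtracting the mean makes \<open>z\<close> orthogonal to
  \<open>1\<close>, and it does not change the image under \<open>L\<close>, since the rows of \<open>L\<close> sum to zero
  (\<open>laplacian_mult_ones\<close>). It remains to see that \<open>L y = r\<close>.

  In a row other than \<open>i\<close>, the zero entry of \<open>y\<close> removes the contribution of the deleted
  column, so this row of \<open>L y = r\<close> is a row of the reduced system
  (\<open>mult_vec_insert_zero\<close>). Row \<open>i\<close> comes for free: \<open>L\<close> is symmetric, so its columns also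
  sum to zero and hence so do the entries of \<open>L y\<close> (\<open>ones_orthogonal_laplacian_mult\<close>). By
  assumption the same is true of \<open>r\<close>, and a vector with known entry sum is determined by
  all its entries but one (\<open>eq_vec_if_ones_prod_eq\<close>).
\<close>

lemma ones_vec_carrier [simp]: "ones_vec n \<in> carrier_vec n"
  by (simp add: ones_vec_def)

lemma ones_scalar_prod: "v \<in> carrier_vec n \<Longrightarrow> ones_vec n \<bullet> v = (\<Sum>k = 0..<n. v $ k)"
  by (auto simp: scalar_prod_def ones_vec_def)

lemma sum_insert_index:
  fixes f :: "nat \<Rightarrow> 'a :: comm_monoid_add"
  assumes "i < Suc m"
  shows "sum f {0..<Suc m} = f i + (\<Sum>k = 0..<m. f (insert_index i k))"
proof -
  have "sum f ({0..<Suc m} - {i}) = (\<Sum>k = 0..<m. f (insert_index i k))"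
    unfolding insert_index_image[OF assms, symmetric]
    by (simp add: sum.reindex insert_index_inj_on)
  then show ?thesis
    using assms sum.remove[of "{0..<Suc m}" i f] by (simp del: sum.op_ivl_Suc)
qed

text \<open>
  Deletion and insertion hide the same index shift behind a case distinction and a
  concatenation. Here both are expressed by \<^const>\<open>insert_index\<close>, the index map that
  also describes \<^const>\<open>mat_delete\<close>, so that their effects can be matched entry by entry.
\<close>

lemma vec_delete_index:
  assumes "v \<in> carrier_vec (Suc m)" "k < m"
  shows "vec_delete v i $ k = v $ insert_index i k"
  using assms by (simp add: vec_delete_def insert_index_def)

lemma vec_insert_zero_carrier:
  assumes "v \<in> carrier_vec m" "i < Suc m"
  shows "vec_insert_zero v i \<in> carrier_vec (Suc m)"
  using assms by (intro carrier_vecI) (simp add: vec_insert_zero_def)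

lemma vec_insert_zero_at:
  assumes "v \<in> carrier_vec m" "i < Suc m"
  shows "vec_insert_zero v i $ i = 0"
  using assms by (simp add: vec_insert_zero_def vec_first_def vec_last_def)

lemma vec_insert_zero_insert_index:
  assumes "v \<in> carrier_vec m" "i < Suc m" "k < m"
  shows "vec_insert_zero v i $ insert_index i k = v $ k"
  using assms by (auto simp: vec_insert_zero_def vec_first_def vec_last_def insert_index_def)

lemma ones_prod_vec_insert_zero:
  assumes "v \<in> carrier_vec m" "i < Suc m"
  shows "ones_vec (Suc m) \<bullet> vec_insert_zero v i = ones_vec m \<bullet> v"
  using assms
  by (simp add: ones_scalar_prod vec_insert_zero_carrier sum_insert_index[OF assms(2)]
      vec_insert_zero_at vec_insert_zero_insert_index del: sum.op_ivl_Suc)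

text \<open>
  A coordinate set to zero makes the corresponding column of the matrix irrelevant, so
  outside row \<open>i\<close> the full product is the product with the reduced matrix.
\<close>

lemma mult_vec_insert_zero:
  fixes A :: "'a :: comm_ring_1 mat"
  assumes A: "A \<in> carrier_mat (Suc m) (Suc m)" and v: "v \<in> carrier_vec m"
    and i: "i < Suc m" and j: "j < m"
  shows "(A *\<^sub>v vec_insert_zero v i) $ insert_index i j = (mat_delete A i i *\<^sub>v v) $ j"
proof -
  have row: "insert_index i j < Suc m"
    using j by (simp add: insert_index_def)
  have "(A *\<^sub>v vec_insert_zero v i) $ insert_index i j
      = (\<Sum>k = 0..<Suc m. A $$ (insert_index i j, k) * vec_insert_zero v i $ k)"
    using A row vec_insert_zero_carrier[OF v i]
    by (auto simp: scalar_prod_def simp del: sum.op_ivl_Suc intro!: sum.cong)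
  also have "\<dots> = (\<Sum>k = 0..<m. mat_delete A i i $$ (j, k) * v $ k)"
    using mat_delete_index[OF A i i j]
    by (simp add: sum_insert_index[OF i] vec_insert_zero_at[OF v i]
        vec_insert_zero_insert_index[OF v i] del: sum.op_ivl_Suc)
  also have "\<dots> = (mat_delete A i i *\<^sub>v v) $ j"
    using A j v by (auto simp: scalar_prod_def intro!: sum.cong)
  finally show ?thesis .
qed

text \<open>
  With the other entries fixed, entry \<open>i\<close> is the entry sum minus their sum. This recovers
  the equation lost with the deleted row.
\<close>

lemma eq_vec_if_ones_prod_eq:
  assumes u: "u \<in> carrier_vec (Suc m)" and v: "v \<in> carrier_vec (Suc m)"
    and i: "i < Suc m"
    and off: "\<And>k. k < m \<Longrightarrow> u $ insert_index i k = v $ insert_index i k"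
    and total: "ones_vec (Suc m) \<bullet> u = ones_vec (Suc m) \<bullet> v"
  shows "u = v"
proof (rule eq_vecI)
  have "u $ i = v $ i"
    using total off
    by (simp add: ones_scalar_prod[OF u] ones_scalar_prod[OF v] sum_insert_index[OF i]
        del: sum.op_ivl_Suc)
  moreover fix k assume "k < dim_vec v"
  then have "k = i \<or> k \<in> insert_index i ` {0..<m}"
    using v insert_index_image[OF i] by auto
  ultimately show "u $ k = v $ k"
    using off by auto
qed (use u v in simp)

lemma laplacian_carrier: "laplacian_mat n G \<in> carrier_mat n n"
  by (intro carrier_matI) (simp_all add: laplacian_mat_def adjacency_mat_def)

text \<open>The degree on the diagonal is by definition the sum of the adjacency row.\<close>

lemma laplacian_mult_ones: "laplacian_mat n G *\<^sub>v ones_vec n = 0\<^sub>v n"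
proof (rule eq_vecI)
  fix j assume "j < dim_vec (0\<^sub>v n :: real vec)"
  then have j: "j < n" by simp
  have "(laplacian_mat n G *\<^sub>v ones_vec n) $ j
      = (\<Sum>k = 0..<n. (if j = k then \<Sum>l = 0..<n. adjacency_mat n G $$ (k, l) else 0)
          - adjacency_mat n G $$ (j, k))"
    using j laplacian_carrier[of n G]
    by (auto simp: scalar_prod_def ones_vec_def laplacian_mat_def degree_mat_def
        mat_diag_def adjacency_mat_def intro!: sum.cong)
  also have "\<dots> = 0"
    using j by (simp add: sum_subtractf)
  finally show "(laplacian_mat n G *\<^sub>v ones_vec n) $ j = 0\<^sub>v n $ j"
    using j by simp
qed (use laplacian_carrier[of n G] in auto)

lemma laplacian_transpose:
  assumes "pair_sym_digraph G"
  shows "transpose_mat (laplacian_mat n G) = laplacian_mat n G"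
proof -
  have sym: "(j, k) \<in> parcs G \<longleftrightarrow> (k, j) \<in> parcs G" for j k
    using pair_sym_digraph.arcs_symmetric[OF assms] by blast
  show ?thesis
    by (rule eq_matI)
       (auto simp: laplacian_mat_def degree_mat_def adjacency_mat_def mat_diag_def sym)
qed

text \<open>
  By symmetry \<open>L\<close> can be moved to the other factor of the scalar product, where it
  annihilates \<open>1\<close>. This is what makes one equation of \<open>L y = r\<close> redundant.
\<close>

lemma ones_orthogonal_laplacian_mult:
  assumes G: "pair_sym_digraph G" and v: "v \<in> carrier_vec n"
  shows "ones_vec n \<bullet> (laplacian_mat n G *\<^sub>v v) = 0"
proof -
  have "ones_vec n \<bullet> (laplacian_mat n G *\<^sub>v v)
      = (transpose_mat (laplacian_mat n G) *\<^sub>v ones_vec n) \<bullet> v"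
    using transpose_vec_mult_scalar[OF laplacian_carrier v, of "ones_vec n"] by simp
  then show ?thesis
    using v by (simp add: laplacian_transpose[OF G] laplacian_mult_ones)
qed

theorem theorem2p4:
  fixes n i :: nat and G :: "nat pair_pre_digraph"
    and L L_hat :: "real mat" and r r_hat z_hat z :: "real vec"
  assumes "pair_graph G" and "pverts G = {0..<n}"
    and "Digraph_Component.connected (with_proj G)"
    and "L = laplacian_mat n G"
    and "r \<in> carrier_vec n" and "ones_vec n \<bullet> r = 0"
    and "i < n"
    and "L_hat = mat_delete L i i" and "r_hat = vec_delete r i"
    and "z_hat \<in> carrier_vec (n - 1)" and "L_hat *\<^sub>v z_hat = r_hat"
    and "z = vec_insert_zero z_hat i - ((ones_vec (n - 1) \<bullet> z_hat) / real n) \<cdot>\<^sub>v ones_vec n"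
  shows "L *\<^sub>v z = r \<and> ones_vec n \<bullet> z = 0"
proof -
  interpret pair_graph G by fact
  obtain m where n: "n = Suc m"
    using \<open>i < n\<close> by (cases n) auto
  have i: "i < Suc m" and z_hat: "z_hat \<in> carrier_vec m" and r: "r \<in> carrier_vec (Suc m)"
    using assms n by simp_all
  have L: "L \<in> carrier_mat n n"
    using assms(4) laplacian_carrier by simp
  define y where "y = vec_insert_zero z_hat i"
  define c where "c = (ones_vec m \<bullet> z_hat) / real n"
  have y: "y \<in> carrier_vec n"
    using vec_insert_zero_carrier[OF z_hat i] by (simp add: y_def n)
  have z: "z = y - c \<cdot>\<^sub>v ones_vec n"
    using assms(12) by (simp add: y_def c_def n)
  have Ly: "L *\<^sub>v y = r"
  proof (rule eq_vec_if_ones_prod_eq)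
    fix k assume k: "k < m"
    have "(L *\<^sub>v y) $ insert_index i k = (mat_delete L i i *\<^sub>v z_hat) $ k"
      unfolding y_def using L n by (intro mult_vec_insert_zero[OF _ z_hat i k]) simp
    also have "\<dots> = r $ insert_index i k"
      using assms(8,9,11) vec_delete_index[OF r k] by simp
    finally show "(L *\<^sub>v y) $ insert_index i k = r $ insert_index i k" .
  next
    show "ones_vec (Suc m) \<bullet> (L *\<^sub>v y) = ones_vec (Suc m) \<bullet> r"
      using ones_orthogonal_laplacian_mult[OF pair_sym_digraph_axioms y] assms(4,6) n by simp
  qed (use L y r i n in auto)
  have "L *\<^sub>v z = L *\<^sub>v y - c \<cdot>\<^sub>v (L *\<^sub>v ones_vec n)"
    unfolding z using L y by (simp add: mult_minus_distrib_mat_vec mult_mat_vec)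
  also have "\<dots> = r"
    unfolding Ly using assms(4,5) by (intro eq_vecI) (simp_all add: laplacian_mult_ones)
  finally have "L *\<^sub>v z = r" .
  moreover have "ones_vec n \<bullet> z = 0"
  proof -
    have "ones_vec n \<bullet> z = ones_vec n \<bullet> y - c * (ones_vec n \<bullet> ones_vec n)"
      unfolding z using y by (simp add: scalar_prod_minus_distrib[where n = n])
    also have "ones_vec n \<bullet> ones_vec n = real n"
      by (simp add: ones_scalar_prod) (simp add: ones_vec_def)
    also have "ones_vec n \<bullet> y = c * real n"
      using ones_prod_vec_insert_zero[OF z_hat i] by (simp add: y_def c_def n)
    finally show ?thesis by simp
  qed
  ultimately show ?thesis by blast
qed

end
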